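(* There exist notions of arithmetic similarity admitting a non-empty exceptional set. That is, there exist a splitting statistic $s$, number fields $K$ and $F$ with $s(p,K)=s(p,F)$ for all but finitely many rational primes $p$ (i.e. $K\sim F$ for the notion of arithmetic similarity induced by $s$), and a rational prime $p$ with $s(p,K)\neq s(p,F)$.
   Context: $\mathbb{N}$ contains $0$, and $\mathcal{M}_{\mathbb{N}}^f$ denotes the set of multisets of natural numbers with finite support, i.e. functions $\mathbb{N}\to\mathbb{N}$ (multiplicity functions) with finite support; $|\cdot|$ denotes the cardinality of a multiset, counted with multiplicity. One identifies $n\in\mathbb{N}$ with the multiset $\{n\}$ (multiplicity $1$ at $n$ and $0$ elsewhere), so $\mathbb{N}\subset\mathcal{M}_{\mathbb{N}}^f$. Splitting type: for a number field $F$ and a rational prime $p$ with $p\mathcal{O}_F=\mathfrak{p}_1^{e_1}\cdots\mathfrak{p}_n^{e_n}$ (distinct primes $\mathfrak p_i$), $S_F(p)\in\mathcal{M}_{\mathbb{N}}^f$ is the multiset $\{f_i\}_{i=1}^n$ of residual degrees $f_i=[\mathcal{O}_F/\mathfrak{p}_i:\mathbb{Z}/p\mathbb{Z}]$. Let $\mathbb{P}$ be the set of rational primes and $\mathcal{N}$ the set of number fields. A splitting statistic is a function $s:\mathbb{P}\times\mathcal{N}\to\mathcal{M}_{\mathbb{N}}^f$ of the form $s(p,F)(n)=f_n(S_F(p))$ for some functions $f_n:\mathcal{M}_{\mathbb{N}}^f\to\mathbb{N}$ ($n\in\mathbb{N}$), and such that $\operatorname{supp}(s(\cdot,F))$ and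 $|s(\cdot,F)|$ are uniformly bounded (for each $F$, bounded independently of $p$). The notion of arithmetic similarity induced by $s$ is the equivalence relation $\sim$ on $\mathcal{N}$ given by $K\sim F$ if $s(p,F)=s(p,K)$ for all but finitely many $p\in\mathbb{P}$. For $K\sim F$, the exceptional set of $s$ for $K$ and $F$ is the set of primes $p$ with $s(p,F)\neq s(p,K)$. A notion of arithmetic similarity admits a non-empty exceptional set if it is induced by a splitting statistic with a non-empty exceptional set for some number fields $K\sim F$. *)

theory Defs
  imports
    "HOL-Algebra.Algebra"
    "HOL-Algebra.Algebraic_Closure_Type"
begin

text \<open>
  Number fields are taken inside the complex numbers, as subfields of finite degree over \<open>\<rat>\<close>.
  Every number field embeds into the complex numbers, and splitting types are invariant under
  isomorphism.
\<close>

abbreviation complex_ring :: "complex ring" where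
  "complex_ring \<equiv> ring_of_type_algebra"

definition number_field :: "complex set \<Rightarrow> bool" where
  "number_field F \<longleftrightarrow>
     subfield F complex_ring \<and> ring.finite_dimension complex_ring (\<rat> :: complex set) F"

definition ring_of_integers :: "complex set \<Rightarrow> complex ring" where
  "ring_of_integers F = complex_ring \<lparr>carrier := {x \<in> F. algebraic_int x}\<rparr>"

text \<open>
  \<^const>\<open>ideals_set\<close> is the commutative monoid of ideals under multiplication, with unit ideal
  \<^term>\<open>carrier R\<close>. The following says that \<open>I\<close> is the product of the powers \<open>P ^ e P\<close> over the
  distinct primes \<open>P \<in> A\<close>.
\<close>

definition prime_ideal_factorization ::
    "complex ring \<Rightarrow> complex set \<Rightarrow> complex set set \<Rightarrow> (complex set \<Rightarrow> nat) \<Rightarrow> bool" where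
  "prime_ideal_factorization R I A e \<longleftrightarrow>
     finite A \<and> (\<forall>P\<in>A. primeideal P R \<and> e P \<ge> 1) \<and>
     I = finprod (ideals_set R) (\<lambda>P. P [^]\<^bsub>ideals_set R\<^esub> e P) A"

text \<open>
  In a ring of integers the factorization of a nonzero ideal exists and is unique, so for
  \<open>p \<noteq> 0\<close> this is the finite set of the primes occurring in the factorization of
  \<open>p\<O>\<^sub>F\<close>.
\<close>

definition primes_above :: "complex set \<Rightarrow> nat \<Rightarrow> complex set set" where
  "primes_above F p =
     {P. \<exists>A e. prime_ideal_factorization (ring_of_integers F)
                 (genideal (ring_of_integers F) {of_nat p}) A e \<and> P \<in> A}"

text \<open>
  The degree is the dimension of \<open>\<O>\<^sub>F/P\<close> over the image of the integers, which is a copy of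
  \<open>\<int>/p\<int>\<close> when \<open>P\<close> lies above \<open>p\<close>.
\<close>

definition residue_degree :: "complex set \<Rightarrow> complex set \<Rightarrow> nat" where
  "residue_degree F P =
     (let R = ring_of_integers F; k = R Quot P
      in ring.dim k (range (\<lambda>z::int. P +>\<^bsub>R\<^esub> of_int z)) (carrier k))"

definition splitting_type :: "complex set \<Rightarrow> nat \<Rightarrow> nat multiset" where
  "splitting_type F p = image_mset (residue_degree F) (mset_set (primes_above F p))"

text \<open>
  Only the values \<open>s p F\<close> with \<open>p\<close> prime and \<open>F\<close> a number field are relevant. The bounds may
  depend on \<open>F\<close> but not on \<open>p\<close>.
\<close>

definition splitting_statistic :: "(nat \<Rightarrow> complex set \<Rightarrow> nat multiset) \<Rightarrow> bool" where
  "splitting_statistic s \<longleftrightarrow>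
     (\<exists>f :: nat \<Rightarrow> nat multiset \<Rightarrow> nat.
        \<forall>p F n. Factorial_Ring.prime p \<longrightarrow> number_field F \<longrightarrow>
          count (s p F) n = f n (splitting_type F p)) \<and>
     (\<forall>F. number_field F \<longrightarrow>
        (\<exists>B. \<forall>p. Factorial_Ring.prime p \<longrightarrow> set_mset (s p F) \<subseteq> {..B}) \<and>
        (\<exists>C. \<forall>p. Factorial_Ring.prime p \<longrightarrow> size (s p F) \<le> C))"

definition exceptional_set ::
    "(nat \<Rightarrow> complex set \<Rightarrow> nat multiset) \<Rightarrow> complex set \<Rightarrow> complex set \<Rightarrow> nat set" where
  "exceptional_set s K F = {p. Factorial_Ring.prime p \<and> s p F \<noteq> s p K}"

definition arithmetic_similarity ::
    "(nat \<Rightarrow> complex set \<Rightarrow> nat multiset) \<Rightarrow> (complex set \<times> complex set) set" where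
  "arithmetic_similarity s =
     {(K, F). number_field K \<and> number_field F \<and> finite (exceptional_set s K F)}"

lemma equiv_arithmetic_similarity: "equiv {F. number_field F} (arithmetic_similarity s)"
proof (rule equivI)
  show "arithmetic_similarity s \<subseteq> {F. number_field F} \<times> {F. number_field F}"
    by (auto simp: arithmetic_similarity_def)
  show "refl_on {F. number_field F} (arithmetic_similarity s)"
    by (auto simp: refl_on_def arithmetic_similarity_def exceptional_set_def)
  have "exceptional_set s K F = exceptional_set s F K" for K F
    by (auto simp: exceptional_set_def)
  then show "sym (arithmetic_similarity s)"
    by (auto simp: sym_def arithmetic_similarity_def)
  have "finite (exceptional_set s K F)"
    if "finite (exceptional_set s K E)" "finite (exceptional_set s E F)" for K E F
  proof (rule finite_subset)
    show "exceptional_set s K F \<subseteq> exceptional_set s K E \<union> exceptional_set s E F"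
      by (auto simp: exceptional_set_def)
  qed (use that in simp)
  then show "trans (arithmetic_similarity s)"
    unfolding trans_def arithmetic_similarity_def by blast
qed

definition admits_nonempty_exceptional_set :: "(complex set \<times> complex set) set \<Rightarrow> bool" where
  "admits_nonempty_exceptional_set S \<longleftrightarrow>
     (\<exists>s. splitting_statistic s \<and> S = arithmetic_similarity s \<and>
          (\<exists>K F. (K, F) \<in> S \<and> exceptional_set s K F \<noteq> {}))"

end

theory Submission
  imports Defs
begin

text \<open>
  Most primes are unramified in a given number field, and a statistic that only records a rare
  splitting type can therefore be constant for almost all primes without being constant. Consider
  the splitting type \<open>{1}\<close>: one prime ideal above \<open>p\<close>, with residue degree 1. In a quadratic
  field this happens exactly at the ramified primes. The statistic with value \<open>{0}\<close> on this type
  and \<open>{}\<close> on all others is thus empty almost everywhere for every quadratic field, so all quadratic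
  fields are similar to each other; but \<open>2\<close> ramifies in \<open>\<rat>(\<i>)\<close> and is inert in \<open>\<rat>(\<omega>)\<close>,
  \<open>\<omega>\<close> a primitive sixth root of unity, hence \<open>2\<close> is exceptional for this pair of fields.

  That an unramified prime does not have type \<open>{1}\<close> needs no factorization
  (\<open>splitting_type_ne_1_unramified\<close>). If \<open>P\<close> is the only prime above \<open>p\<close>, then
  \<open>p\<O> = P\<^sup>e\<close>, which makes \<open>P\<close> stable under complex conjugation. If moreover
  \<open>\<O>/P\<close> has degree 1, the generator \<open>\<theta>\<close> of \<open>\<O> = \<int>[\<theta>]\<close> is congruent to an integer
  modulo \<open>P\<close>, and so is its conjugate, to the same integer. Hence \<open>\<theta> - \<theta>'\<close> lies in \<open>P\<close>,
  and \<open>p\<close> divides its square, the discriminant. For \<open>\<rat>(\<i>)\<close> the equation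
  \<open>(2) = (1 + \<i>)\<^sup>2\<close> gives the type \<open>{1}\<close> at \<open>2\<close> (\<open>splitting_type_gaussian_2\<close>).

  Both arguments rest on knowing that the ring of integers is \<open>\<int>[\<theta>]\<close>
  (\<open>algebraic_int_iff_quadratic_order\<close>), which is proved for norm-Euclidean \<open>\<int>[\<theta>]\<close>.
\<close>

section \<open>The ring structure on the complex numbers\<close>

lemma complex_ring_simps [simp]:
  "carrier complex_ring = UNIV"
  "x \<otimes>\<^bsub>complex_ring\<^esub> y = x * y"
  "x \<oplus>\<^bsub>complex_ring\<^esub> y = x + y"
  "\<one>\<^bsub>complex_ring\<^esub> = 1"
  "\<zero>\<^bsub>complex_ring\<^esub> = 0"
  by (simp_all add: ring_of_type_algebra_def)

lemma complex_ring_uminus [simp]: "\<ominus>\<^bsub>complex_ring\<^esub> x = - x"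
  by (rule abelian_group.minus_equality[OF ring.is_abelian_group])
    auto

lemma complex_ring_inverse [simp]:
  assumes "x \<noteq> 0"
  shows "inv\<^bsub>complex_ring\<^esub> x = inverse x"
  by (rule comm_monoid.comm_inv_char[OF cring.axioms(2)])
    (use assms in auto)

section \<open>Norm-Euclidean imaginary quadratic fields\<close>

lemma complex_Rats_imp_Reals:
  fixes q :: complex
  shows "q \<in> \<rat> \<Longrightarrow> q \<in> \<real>"
  by (erule Rats_cases') auto

text \<open>
  The bound on the imaginary part makes \<open>\<int>[\<theta>]\<close> Euclidean for the norm. As
  \<open>4 (Im \<theta>)\<^sup>2\<close> is minus the discriminant, it leaves the discriminants \<open>-3\<close>, \<open>-4\<close>, \<open>-7\<close>,
  \<open>-8\<close> and \<open>-11\<close>.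
\<close>

locale norm_euclidean_quadratic =
  fixes \<theta> :: complex and t n :: int
  assumes trace: "\<theta> + cnj \<theta> = of_int t"
    and norm: "\<theta> * cnj \<theta> = of_int n"
    and nonreal: "Im \<theta> \<noteq> 0"
    and small: "(Im \<theta>)\<^sup>2 < 3"
begin

definition quadratic_field :: "complex set" where
  "quadratic_field = {a + b * \<theta> |a b. a \<in> \<rat> \<and> b \<in> \<rat>}"

definition quadratic_order :: "complex set" where
  "quadratic_order = {a + b * \<theta> |a b. a \<in> \<int> \<and> b \<in> \<int>}"

lemma cnj_theta: "cnj \<theta> = of_int t - \<theta>"
  using trace by (simp add: algebra_simps eq_diff_eq)

lemma theta_square: "\<theta> * \<theta> = of_int t * \<theta> - of_int n"
  using norm unfolding cnj_theta by (simp add: algebra_simps)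

lemma quadratic_fieldI: "a \<in> \<rat> \<Longrightarrow> b \<in> \<rat> \<Longrightarrow> a + b * \<theta> \<in> quadratic_field"
  unfolding quadratic_field_def by blast

lemma quadratic_fieldE:
  assumes "x \<in> quadratic_field"
  obtains a b where "a \<in> \<rat>" "b \<in> \<rat>" "x = a + b * \<theta>"
  using assms unfolding quadratic_field_def by blast

lemma quadratic_orderI: "a \<in> \<int> \<Longrightarrow> b \<in> \<int> \<Longrightarrow> a + b * \<theta> \<in> quadratic_order"
  unfolding quadratic_order_def by blast

lemma quadratic_orderE:
  assumes "x \<in> quadratic_order"
  obtains a b :: int where "x = of_int a + of_int b * \<theta>"
  using assms unfolding quadratic_order_def Ints_def by blast

lemma quadratic_order_subset_quadratic_field: "quadratic_order \<subseteq> quadratic_field"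
  using Ints_subset_Rats unfolding quadratic_order_def quadratic_field_def by blast

lemma Ints_in_quadratic_order: "x \<in> \<int> \<Longrightarrow> x \<in> quadratic_order"
  using quadratic_orderI[of x 0] by simp

lemma of_int_in_quadratic_order [simp]: "of_int z \<in> quadratic_order"
  by (simp add: Ints_in_quadratic_order)

lemma of_nat_in_quadratic_order [simp]: "of_nat k \<in> quadratic_order"
  by (simp add: Ints_in_quadratic_order)

lemma Rats_in_quadratic_field: "x \<in> \<rat> \<Longrightarrow> x \<in> quadratic_field"
  using quadratic_fieldI[of x 0] by simp

lemma theta_in_quadratic_order: "\<theta> \<in> quadratic_order"
  using quadratic_orderI[of 0 1] by simp

lemma mult_coordinates:
  "(a + b * \<theta>) * (c + d * \<theta>) =
    (a * c - b * d * of_int n) + (a * d + b * c + b * d * of_int t) * \<theta>"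
proof -
  have "(a + b * \<theta>) * (c + d * \<theta>) = a * c + (a * d + b * c) * \<theta> + b * d * (\<theta> * \<theta>)"
    by (simp add: algebra_simps)
  then show ?thesis
    unfolding theta_square by (simp add: algebra_simps)
qed

lemma quadratic_order_add: "x \<in> quadratic_order \<Longrightarrow> y \<in> quadratic_order \<Longrightarrow> x + y \<in> quadratic_order"
proof (elim quadratic_orderE)
  fix a b c d :: int
  assume "x = of_int a + of_int b * \<theta>" "y = of_int c + of_int d * \<theta>"
  then show "x + y \<in> quadratic_order"
    using quadratic_orderI[of "of_int (a + c)" "of_int (b + d)"] by (simp add: algebra_simps)
qed

lemma quadratic_order_mult:
  assumes "x \<in> quadratic_order" "y \<in> quadratic_order"
  shows "x * y \<in> quadratic_order"
proof -
  obtain a b c d :: int where "x = of_int a + of_int b * \<theta>" "y = of_int c + of_int d * \<theta>"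
    using assms by (elim quadratic_orderE)
  then show ?thesis
    unfolding mult_coordinates[of "of_int a"] by (auto simp: mult_coordinates intro!: quadratic_orderI)
qed

lemma quadratic_order_uminus: "x \<in> quadratic_order \<Longrightarrow> - x \<in> quadratic_order"
  using quadratic_order_mult[of "-1" x] Ints_in_quadratic_order by simp

lemma quadratic_order_diff: "x \<in> quadratic_order \<Longrightarrow> y \<in> quadratic_order \<Longrightarrow> x - y \<in> quadratic_order"
  using quadratic_order_add[of x "- y"] quadratic_order_uminus by simp

lemma quadratic_order_power: "x \<in> quadratic_order \<Longrightarrow> x ^ k \<in> quadratic_order"
  by (induction k) (auto intro: quadratic_order_mult Ints_in_quadratic_order)

lemma quadratic_order_sum: "(\<And>i. i \<in> A \<Longrightarrow> f i \<in> quadratic_order) \<Longrightarrow> sum f A \<in> quadratic_order"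
  by (induction A rule: infinite_finite_induct)
    (auto intro: quadratic_order_add Ints_in_quadratic_order)

lemma quadratic_order_cnj: "x \<in> quadratic_order \<Longrightarrow> cnj x \<in> quadratic_order"
  by (elim quadratic_orderE)
    (auto simp: cnj_theta intro!: quadratic_order_add quadratic_order_mult quadratic_order_diff
      theta_in_quadratic_order
      intro: Ints_in_quadratic_order)

lemma quadratic_field_add: "x \<in> quadratic_field \<Longrightarrow> y \<in> quadratic_field \<Longrightarrow> x + y \<in> quadratic_field"
proof (elim quadratic_fieldE)
  fix a b c d assume "a \<in> \<rat>" "b \<in> \<rat>" "c \<in> \<rat>" "d \<in> \<rat>"
    and "x = a + b * \<theta>" "y = c + d * \<theta>"
  then show "x + y \<in> quadratic_field"
    using quadratic_fieldI[of "a + c" "b + d"] by (simp add: algebra_simps)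
qed

lemma quadratic_field_mult: "x \<in> quadratic_field \<Longrightarrow> y \<in> quadratic_field \<Longrightarrow> x * y \<in> quadratic_field"
  by (elim quadratic_fieldE) (auto simp: mult_coordinates intro!: quadratic_fieldI)

lemma quadratic_field_cnj: "x \<in> quadratic_field \<Longrightarrow> cnj x \<in> quadratic_field"
proof (elim quadratic_fieldE)
  fix a b assume ab: "a \<in> \<rat>" "b \<in> \<rat>" and x: "x = a + b * \<theta>"
  have "cnj x = (a + b * of_int t) + (- b) * \<theta>"
    using ab by (simp add: x cnj_theta Reals_cnj_iff[THEN iffD1] complex_Rats_imp_Reals algebra_simps)
  then show "cnj x \<in> quadratic_field"
    using ab quadratic_fieldI[of "a + b * of_int t" "- b"] by simp
qed

lemma norm_coordinates:
  assumes "a \<in> \<real>" "b \<in> \<real>"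
  shows "(a + b * \<theta>) * cnj (a + b * \<theta>) = a * a + a * b * of_int t + b * b * of_int n"
proof -
  have [simp]: "cnj a = a" "cnj b = b"
    using assms by (auto simp: Reals_cnj_iff)
  have "(a + b * \<theta>) * cnj (a + b * \<theta>) = a * a + a * b * (\<theta> + cnj \<theta>) + b * b * (\<theta> * cnj \<theta>)"
    by (simp add: algebra_simps)
  then show ?thesis
    unfolding trace norm .
qed

lemma quadratic_field_inverse:
  assumes "x \<in> quadratic_field"
  shows "inverse x \<in> quadratic_field"
proof (cases "x = 0")
  case False
  obtain a b where ab: "a \<in> \<rat>" "b \<in> \<rat>" and x: "x = a + b * \<theta>"
    using assms by (rule quadratic_fieldE)
  then have real: "a \<in> \<real>" "b \<in> \<real>"
    by (auto intro: complex_Rats_imp_Reals)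
  define m where "m = x * cnj x"
  have "m \<in> \<rat>"
    unfolding m_def x norm_coordinates[OF real] using ab by auto
  then have "cnj x * inverse m \<in> quadratic_field"
    using quadratic_field_mult[OF quadratic_field_cnj[OF assms]
        Rats_in_quadratic_field[OF Rats_inverse]] by blast
  moreover have "cnj x * inverse m = inverse x"
    using False by (simp add: m_def field_simps)
  ultimately show ?thesis
    by simp
qed (use Rats_in_quadratic_field in simp)

text \<open>
  Rounding the coordinate along \<open>\<theta>\<close> first and the real part afterwards leaves a remainder with
  real part at most \<open>1/2\<close> and imaginary part at most \<open>\<bar>Im \<theta>\<bar>/2\<close> in absolute value, and
  \<open>1/4 + (Im \<theta>)\<^sup>2/4 < 1\<close>.
\<close>

lemma euclidean: "\<exists>l\<in>quadratic_order. cmod (z - l) < 1"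
proof -
  define b where "b = round (Im z / Im \<theta>)"
  define a where "a = round (Re (z - of_int b * \<theta>))"
  define y where "y = z - (of_int a + of_int b * \<theta>)"
  have "Re y = - (of_int a - Re (z - of_int b * \<theta>))"
    by (simp add: y_def)
  then have "\<bar>Re y\<bar> \<le> 1 / 2"
    unfolding a_def using of_int_round_abs_le[of "Re (z - of_int b * \<theta>)"]
    by (simp only: abs_minus_cancel)
  then have Re: "(Re y)\<^sup>2 \<le> (1 / 2)\<^sup>2"
    by (rule abs_le_square_iff[THEN iffD1, OF order_trans]) simp
  have "Im y = - (of_int b - Im z / Im \<theta>) * Im \<theta>"
    using nonreal by (simp add: y_def field_simps)
  then have "\<bar>Im y\<bar> = \<bar>of_int b - Im z / Im \<theta>\<bar> * \<bar>Im \<theta>\<bar>"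
    by (simp add: abs_mult abs_minus_commute)
  also have "\<dots> \<le> 1 / 2 * \<bar>Im \<theta>\<bar>"
    unfolding b_def by (intro mult_right_mono of_int_round_abs_le) auto
  finally have Im: "(Im y)\<^sup>2 \<le> (1 / 2 * Im \<theta>)\<^sup>2"
    by (intro abs_le_square_iff[THEN iffD1]) (simp add: abs_mult)
  have "(cmod y)\<^sup>2 = (Re y)\<^sup>2 + (Im y)\<^sup>2"
    by (rule cmod_power2)
  also have "\<dots> < 1\<^sup>2"
    using Re Im small by (simp add: power2_eq_square)
  finally have "cmod y < 1"
    by (rule power2_less_imp_less) simp
  moreover have "of_int a + of_int b * \<theta> \<in> quadratic_order"
    by (intro quadratic_orderI) auto
  ultimately show ?thesis
    unfolding y_def by blast
qed

text \<open>
  The square of the absolute value is the norm, an integer.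
\<close>

lemma one_le_cmod_quadratic_order:
  assumes "x \<in> quadratic_order" "x \<noteq> 0"
  shows "1 \<le> cmod x"
proof -
  obtain a b :: int where x: "x = of_int a + of_int b * \<theta>"
    using assms by (elim quadratic_orderE)
  define m where "m = a * a + a * b * t + b * b * n"
  have "complex_of_real ((cmod x)\<^sup>2) = complex_of_real (of_int m)"
    unfolding complex_norm_square x by (subst norm_coordinates) (auto simp: m_def)
  then have m: "(cmod x)\<^sup>2 = of_int m"
    by (simp only: of_real_eq_iff)
  moreover have "0 < (cmod x)\<^sup>2"
    using assms by simp
  ultimately have "1 \<le> m"
    by linarith
  then show ?thesis
    using m by (intro power2_le_imp_le[of 1 "cmod x"]) auto
qed

lemma algebraic_int_quadratic_order:
  assumes "x \<in> quadratic_order"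
  shows "algebraic_int x"
proof -
  obtain a b :: int where x: "x = of_int a + of_int b * \<theta>"
    using assms by (elim quadratic_orderE)
  define p where "p = [: a * a + a * b * t + b * b * n, - (2 * a + b * t), 1 :]"
  have "x * cnj x = of_int (a * a + a * b * t + b * b * n)"
    unfolding x by (subst norm_coordinates) auto
  moreover have "x + cnj x = of_int (2 * a + b * t)"
    by (simp add: x cnj_theta algebra_simps)
  ultimately have "poly (map_poly of_int p) x = x * cnj x - x * (x + cnj x) + x * x"
    by (simp add: p_def map_poly_pCons algebra_simps)
  then have "poly (map_poly of_int p) x = 0"
    by (simp add: algebra_simps)
  moreover have "lead_coeff p = 1"
    by (simp add: p_def)
  ultimately show ?thesis
    unfolding algebraic_int_altdef_ipoly by blast
qed

lemma quadratic_field_common_denominator: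
  assumes "x \<in> quadratic_field"
  obtains d :: int where "d > 0" "of_int d * x \<in> quadratic_order"
proof -
  obtain a b where ab: "a \<in> \<rat>" "b \<in> \<rat>" and x: "x = a + b * \<theta>"
    using assms by (rule quadratic_fieldE)
  obtain p q where q: "q > 0" "a = of_int p / of_int q"
    using ab(1) by (auto elim: Rats_cases')
  obtain r s where s: "s > 0" "b = of_int r / of_int s"
    using ab(2) by (auto elim: Rats_cases')
  have "of_int (q * s) * x = of_int (p * s) + of_int (r * q) * \<theta>"
    using q s by (simp add: x field_simps)
  then have "of_int (q * s) * x \<in> quadratic_order"
    using quadratic_orderI by (metis Ints_of_int)
  with q s show thesis
    by (intro that[of "q * s"]) auto
qed

text \<open>
  An integral equation of degree \<open>m\<close> expresses all powers of \<open>x\<close> through the first \<open>m\<close> of them, so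
  a common denominator of these serves all powers.
\<close>

lemma bounded_denominators:
  assumes "x \<in> quadratic_field" "algebraic_int x"
  obtains d :: int where "d > 0" "\<And>k. of_int d * x ^ k \<in> quadratic_order"
proof -
  obtain d where d: "d > 0" "of_int d * x \<in> quadratic_order"
    using assms(1) by (rule quadratic_field_common_denominator)
  obtain p where p: "lead_coeff p = 1" "\<And>i. coeff p i \<in> \<int>" "poly p x = 0"
    using assms(2) by (auto elim: algebraic_int.cases)
  define m where "m = degree p"
  have rec: "x ^ m = - (\<Sum>i<m. coeff p i * x ^ i)"
  proof -
    have "0 = (\<Sum>i\<le>m. coeff p i * x ^ i)"
      using p(3) by (simp add: poly_altdef m_def)
    also have "\<dots> = (\<Sum>i<m. coeff p i * x ^ i) + x ^ m"
      using p(1) by (simp add: m_def flip: lessThan_Suc_atMost)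
    finally show ?thesis
      by (simp add: eq_neg_iff_add_eq_0 add.commute)
  qed
  have "of_int (d ^ m) * x ^ k \<in> quadratic_order" for k
  proof (induction k rule: less_induct)
    case (less k)
    show ?case
    proof (cases "k < m")
      case True
      have "of_int (d ^ m) * x ^ k = of_int (d ^ (m - k)) * (of_int d * x) ^ k"
        using True by (simp add: power_mult_distrib flip: power_add)
      then show ?thesis
        using d(2) by (auto intro!: quadratic_order_mult quadratic_order_power
          intro: Ints_in_quadratic_order)
    next
      case False
      have "x ^ k = x ^ (k - m) * x ^ m"
        using False by (simp flip: power_add)
      then have "of_int (d ^ m) * x ^ k =
          (\<Sum>i<m. - coeff p i * (of_int (d ^ m) * x ^ (k - m + i)))"
        unfolding rec by (simp add: sum_distrib_left power_add mult_ac sum_negf)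
      also have "\<dots> \<in> quadratic_order"
        using False p(2) by (intro quadratic_order_sum quadratic_order_mult less)
          (auto intro: Ints_in_quadratic_order)
      finally show ?thesis .
    qed
  qed
  with d show thesis
    by (intro that[of "d ^ m"]) auto
qed

text \<open>
  For the direction from left to right, let \<open>d\<close> be a common denominator of the powers of \<open>x\<close>. By
  the binomial theorem it serves also for \<open>y = x - l\<close>, where \<open>l\<close> in \<open>\<int>[\<theta>]\<close> is chosen with
  \<open>\<bar>y\<bar> < 1\<close>. The elements \<open>d y\<^sup>k\<close> of \<open>\<int>[\<theta>]\<close> tend to 0, but nonzero elements have absolute
  value at least 1; so \<open>y = 0\<close>.
\<close>

lemma algebraic_int_iff_quadratic_order:
  assumes "x \<in> quadratic_field"
  shows "algebraic_int x \<longleftrightarrow> x \<in> quadratic_order"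
proof
  assume "algebraic_int x"
  then obtain d where d: "d > 0" "\<And>k. of_int d * x ^ k \<in> quadratic_order"
    using assms bounded_denominators by blast
  obtain l where l: "l \<in> quadratic_order" and less_1: "cmod (x - l) < 1"
    using euclidean by blast
  define y where "y = x - l"
  have dy: "of_int d * y ^ k \<in> quadratic_order" for k
  proof -
    have "of_int d * y ^ k = (\<Sum>i\<le>k. of_nat (k choose i) * ((of_int d * x ^ i) * (- l) ^ (k - i)))"
      using binomial_ring[of x "- l" k] by (simp add: y_def sum_distrib_left mult_ac)
    also have "\<dots> \<in> quadratic_order"
      using l by (intro quadratic_order_sum quadratic_order_mult quadratic_order_power d
          quadratic_order_uminus)
        (auto intro: Ints_in_quadratic_order)
    finally show ?thesis .
  qed
  have "(\<lambda>k. cmod (of_int d) * cmod y ^ k) \<longlonglongrightarrow> cmod (of_int d) * 0"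
    using less_1 by (intro tendsto_mult tendsto_const LIMSEQ_power_zero) (auto simp: y_def)
  then have "eventually (\<lambda>k. cmod (of_int d) * cmod y ^ k < 1) sequentially"
    by (intro order_tendstoD) auto
  then obtain k where "cmod (of_int d * y ^ k) < 1"
    by (auto simp: norm_mult norm_power eventually_sequentially)
  then have "of_int d * y ^ k = 0"
    using one_le_cmod_quadratic_order[OF dy[of k]] by auto
  then have "y = 0"
    using d by auto
  then show "x \<in> quadratic_order"
    using l by (simp add: y_def)
qed (rule algebraic_int_quadratic_order)

lemma integers_eq: "ring_of_integers quadratic_field = complex_ring \<lparr>carrier := quadratic_order\<rparr>"
proof -
  have "{x \<in> quadratic_field. algebraic_int x} = quadratic_order"
    using algebraic_int_iff_quadratic_order quadratic_order_subset_quadratic_field by blast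
  then show ?thesis
    unfolding ring_of_integers_def by simp
qed

lemma number_field_quadratic_field: "number_field quadratic_field"
proof -
  interpret C: Ring.field complex_ring
    by (rule field_from_type_algebra)
  have quadratic_subfield: "subfield quadratic_field complex_ring"
  proof (intro C.subfieldI' C.subringI)
    show "\<And>h. h \<in> quadratic_field \<Longrightarrow> \<ominus>\<^bsub>complex_ring\<^esub> h \<in> quadratic_field"
      using quadratic_field_mult[of "-1"] Rats_in_quadratic_field[of "-1"] by simp
  qed (auto intro: quadratic_field_add quadratic_field_mult quadratic_field_inverse Rats_in_quadratic_field)
  have Rats_subfield: "subfield (\<rat> :: complex set) complex_ring"
    by (intro C.subfieldI' C.subringI) auto
  have "x \<in> C.Span \<rat> [1, \<theta>] \<longleftrightarrow> (\<exists>a\<in>\<rat>. \<exists>b\<in>\<rat>. x = a + b * \<theta>)" for x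
    by (simp add: C.line_extension_mem_iff) (auto simp: C.line_extension_mem_iff Bex_def)
  then have "C.Span \<rat> [1, \<theta>] = quadratic_field"
    unfolding quadratic_field_def by blast
  then have "C.finite_dimension \<rat> quadratic_field"
    using C.Span_finite_dimension[OF Rats_subfield, of "[1, \<theta>]"] by simp
  with quadratic_subfield show ?thesis
    unfolding number_field_def by blast
qed

end

section \<open>Ideals in a factorization, and residue fields of degree 1\<close>

lemma (in cring) ideal_pow_subset:
  assumes "ideal P R" "e \<ge> 1"
  shows "P [^]\<^bsub>ideals_set R\<^esub> (e :: nat) \<subseteq> P"
proof -
  interpret M: comm_monoid "ideals_set R"
    by (rule ideals_set_is_comm_monoid)
  obtain k where "e = Suc k"
    using assms(2) by (cases e) auto
  moreover have "ideal (P [^]\<^bsub>ideals_set R\<^esub> k) R"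
    using M.nat_pow_closed[of P k] assms(1) by (simp add: ideals_set_def)
  then have "(P [^]\<^bsub>ideals_set R\<^esub> k) \<cdot>\<^bsub>R\<^esub> P \<subseteq> P"
    using ideal_prod_inter assms(1) by blast
  ultimately show ?thesis
    by (simp add: M.nat_pow_Suc) (simp add: ideals_set_def)
qed

lemma (in cring) pow_mem_ideal_pow:
  assumes "x \<in> P"
  shows "x [^] e \<in> P [^]\<^bsub>ideals_set R\<^esub> (e :: nat)"
proof (induction e)
  case 0
  show ?case
    by (simp add: nat_pow_def) (simp add: ideals_set_def)
next
  case (Suc e)
  then have "x [^] e \<otimes> x \<in> (P [^]\<^bsub>ideals_set R\<^esub> e) \<cdot>\<^bsub>R\<^esub> P"
    using assms by (rule ideal_prod.prod)
  then show ?case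
    by (simp add: nat_pow_def) (simp add: ideals_set_def)
qed

text \<open>
  A product of ideals is contained in each factor.
\<close>

lemma prime_ideal_factorization_subset:
  assumes "cring R" and fact: "prime_ideal_factorization R I A e" and P: "P \<in> A"
  shows "I \<subseteq> P"
proof -
  interpret cring R by fact
  interpret M: comm_monoid "ideals_set R"
    by (rule ideals_set_is_comm_monoid)
  have A: "finite A" "\<And>Q. Q \<in> A \<Longrightarrow> ideal Q R" "e P \<ge> 1"
    and I: "I = finprod (ideals_set R) (\<lambda>Q. Q [^]\<^bsub>ideals_set R\<^esub> e Q) A"
    using fact P unfolding prime_ideal_factorization_def by (auto intro: primeideal.axioms(1))
  have pow: "Q [^]\<^bsub>ideals_set R\<^esub> e Q \<in> carrier (ideals_set R)" if "Q \<in> A" for Q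
    using that A(2) by (intro M.nat_pow_closed) (simp add: ideals_set_def)
  define J where "J = finprod (ideals_set R) (\<lambda>Q. Q [^]\<^bsub>ideals_set R\<^esub> e Q) (A - {P})"
  have "J \<in> carrier (ideals_set R)"
    unfolding J_def using pow by (intro M.finprod_closed) auto
  have "I = finprod (ideals_set R) (\<lambda>Q. Q [^]\<^bsub>ideals_set R\<^esub> e Q) (insert P (A - {P}))"
    using P by (simp add: I insert_absorb)
  also have "\<dots> = (P [^]\<^bsub>ideals_set R\<^esub> e P) \<otimes>\<^bsub>ideals_set R\<^esub> J"
    unfolding J_def using A(1) pow P by (intro M.finprod_insert) auto
  also have "\<dots> = (P [^]\<^bsub>ideals_set R\<^esub> e P) \<cdot>\<^bsub>R\<^esub> J"
    by (simp add: ideals_set_def)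
  also have "\<dots> \<subseteq> P [^]\<^bsub>ideals_set R\<^esub> e P"
    using ideal_prod_inter[of "P [^]\<^bsub>ideals_set R\<^esub> e P" J] pow[OF P] \<open>J \<in> _\<close>
    by (simp add: ideals_set_def)
  also have "\<dots> \<subseteq> P"
    using A P by (intro ideal_pow_subset) auto
  finally show ?thesis .
qed

lemma primes_above_imp_prime:
  assumes "cring (ring_of_integers F)" "of_nat p \<in> carrier (ring_of_integers F)"
    and "P \<in> primes_above F p"
  shows "primeideal P (ring_of_integers F)" "of_nat p \<in> P"
proof -
  interpret cring "ring_of_integers F" by fact
  obtain A e where *: "prime_ideal_factorization (ring_of_integers F)
      (genideal (ring_of_integers F) {of_nat p}) A e" "P \<in> A"
    using assms(3) unfolding primes_above_def by blast
  then show "primeideal P (ring_of_integers F)"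
    unfolding prime_ideal_factorization_def by blast
  show "of_nat p \<in> P"
    using prime_ideal_factorization_subset[OF assms(1) *] genideal_self'[OF assms(2)] by blast
qed

text \<open>
  By the definition of \<^const>\<open>primes_above\<close>, all primes in any one factorization of \<open>p\<O>\<close> are primes
  above \<open>p\<close>; so no other prime than \<open>P\<close> can occur with it.
\<close>

lemma primes_above_singleton:
  assumes "cring (ring_of_integers F)" and "primes_above F p = {P}"
  obtains e where "e \<ge> 1"
    "genideal (ring_of_integers F) {of_nat p} = P [^]\<^bsub>ideals_set (ring_of_integers F)\<^esub> (e :: nat)"
proof -
  interpret cring "ring_of_integers F" by fact
  interpret M: comm_monoid "ideals_set (ring_of_integers F)"
    by (rule ideals_set_is_comm_monoid)
  obtain A e where *: "prime_ideal_factorization (ring_of_integers F)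
      (genideal (ring_of_integers F) {of_nat p}) A e" "P \<in> A"
    using assms(2) unfolding primes_above_def by blast
  have "A \<subseteq> primes_above F p"
    using *(1) unfolding primes_above_def by blast
  then have A: "A = {P}"
    using *(2) assms(2) by blast
  have P: "primeideal P (ring_of_integers F)" "e P \<ge> 1"
    and eq: "genideal (ring_of_integers F) {of_nat p} =
      finprod (ideals_set (ring_of_integers F))
        (\<lambda>Q. Q [^]\<^bsub>ideals_set (ring_of_integers F)\<^esub> e Q) {P}"
    using * unfolding prime_ideal_factorization_def A by auto
  have "P \<in> carrier (ideals_set (ring_of_integers F))"
    using P(1) by (simp add: ideals_set_def primeideal.axioms(1))
  then show thesis
    using P(2) eq by (intro that[of "e P"]) auto
qed

lemma splitting_type_singletonE:
  assumes "splitting_type F p = {#f#}"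
  obtains P where "primes_above F p = {P}" "residue_degree F P = f"
proof -
  have "size (mset_set (primes_above F p)) = 1"
    using arg_cong[OF assms, of size] by (simp add: splitting_type_def)
  then have "card (primes_above F p) = 1"
    by simp
  then obtain P where "primes_above F p = {P}"
    by (auto simp: card_1_singleton_iff)
  then show thesis
    using assms by (intro that[of P]) (auto simp: splitting_type_def)
qed

text \<open>
  The finiteness hypothesis matters: \<^const>\<open>ring.dim\<close> is a definite description, with an unspecified
  value on spaces of infinite dimension.
\<close>

lemma (in ring) dim_eq_1_iff:
  assumes K: "subfield K R" and fin: "finite_dimension K (carrier R)"
  shows "dim K (carrier R) = 1 \<longleftrightarrow> carrier R = K"
proof
  assume "carrier R = K"
  then show "dim K (carrier R) = 1"
    using dimI[OF K dimension_one[OF K]] by (simp add: over_def)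
next
  assume "dim K (carrier R) = 1"
  then have dim: "dimension 1 K (carrier R)"
    using finite_dimensionE[OF K fin] by (simp add: over_def)
  have one: "\<one> \<in> K"
    using subfieldE(1)[OF K] by (rule subringE(3))
  have "independent K [\<one>]"
    using subfieldE(6)[OF K] by (intro li_Cons) auto
  then have "Span K [\<one>] = K" "Span K [\<one>] = carrier R"
    using independent_length_eq_dimension[OF K dimension_one[OF K], of "[\<one>]"]
      independent_length_eq_dimension[OF K dim, of "[\<one>]"] one subfieldE(3)[OF K] by auto
  then show "carrier R = K"
    by simp
qed

section \<open>Unramified primes of an imaginary quadratic field\<close>

context norm_euclidean_quadratic
begin

abbreviation integers :: "complex ring" where
  "integers \<equiv> ring_of_integers quadratic_field"

lemma integers_simps [simp]:
  "carrier integers = quadratic_order"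
  "x \<otimes>\<^bsub>integers\<^esub> y = x * y"
  "x \<oplus>\<^bsub>integers\<^esub> y = x + y"
  "\<one>\<^bsub>integers\<^esub> = 1"
  "\<zero>\<^bsub>integers\<^esub> = 0"
  by (simp_all add: integers_eq)

lemma cring_integers: "cring integers"
proof -
  interpret C: cring complex_ring by auto
  have "subcring quadratic_order complex_ring"
    by (intro C.subcringI' C.subringI)
      (auto intro: quadratic_order_add quadratic_order_mult quadratic_order_uminus Ints_in_quadratic_order)
  then show ?thesis
    unfolding integers_eq using C.subcring_iff by auto
qed

sublocale integers: cring integers
  by (rule cring_integers)

lemma integers_uminus [simp]: "x \<in> quadratic_order \<Longrightarrow> \<ominus>\<^bsub>integers\<^esub> x = - x"
  by (rule integers.minus_equality) (auto intro: quadratic_order_uminus)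

lemma integers_minus [simp]: "y \<in> quadratic_order \<Longrightarrow> x \<ominus>\<^bsub>integers\<^esub> y = x - y"
  by (simp add: a_minus_def)

lemma integers_pow [simp]: "x [^]\<^bsub>integers\<^esub> (k :: nat) = x ^ k"
  by (induction k) (auto simp: nat_pow_def mult.commute)

lemma coset_eq_iff:
  assumes "ideal P integers" "x \<in> quadratic_order" "y \<in> quadratic_order"
  shows "P +>\<^bsub>integers\<^esub> x = P +>\<^bsub>integers\<^esub> y \<longleftrightarrow> x - y \<in> P"
  using integers.quotient_eq_iff_same_a_r_cos[of P x y] assms by auto

lemma int_mem_prime_iff:
  assumes P: "primeideal P integers" and p: "Factorial_Ring.prime p" "of_nat p \<in> P"
  shows "of_int z \<in> P \<longleftrightarrow> int p dvd z"
proof -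
  interpret P: primeideal P integers by fact
  show ?thesis
  proof
    assume z: "of_int z \<in> P"
    show "int p dvd z"
    proof (rule ccontr)
      assume "\<not> int p dvd z"
      then have "Rings.coprime (int p) z"
        using p(1) by (intro prime_imp_coprime) auto
      then obtain u v where uv: "u * int p + v * z = 1"
        using bezout_int[of "int p" z] by auto
      have "of_int u * of_nat p + of_int v * of_int z \<in> P"
        using P.I_l_closed[OF p(2), of "of_int u"] P.I_l_closed[OF z, of "of_int v"]
          P.a_closed[of "of_int u * of_nat p" "of_int v * of_int z"]
        by simp
      then have "1 \<in> P"
        using arg_cong[OF uv, of complex_of_int] by simp
      then show False
        using P.one_imp_carrier P.I_notcarr by auto
    qed
  next
    assume "int p dvd z"
    then obtain w where "z = int p * w" ..
    then show "of_int z \<in> P"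
      using P.I_r_closed[OF p(2), of "of_int w"] by auto
  qed
qed

text \<open>
  The image of \<open>\<int>\<close> in \<open>\<O>/P\<close> is a field because \<open>P\<close> contains the prime \<open>p\<close>, and \<open>\<O>/P\<close>
  is spanned over it by 1 and \<open>\<theta>\<close>; so the dimension is 1 exactly if the image of \<open>\<int>\<close> is
  everything.
\<close>

lemma residue_degree_eq_1_iff:
  assumes P: "primeideal P integers" and p: "Factorial_Ring.prime p" "of_nat p \<in> P"
  shows "residue_degree quadratic_field P = 1 \<longleftrightarrow>
    (\<forall>x\<in>quadratic_order. \<exists>z :: int. x - of_int z \<in> P)"
proof -
  interpret P: primeideal P integers by fact
  define k where "k = integers Quot P"
  define \<pi> where "\<pi> = (\<lambda>x. P +>\<^bsub>integers\<^esub> x)"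
  interpret k: domain k
    unfolding k_def by (rule P.quotient_is_domain)
  interpret \<pi>: ring_hom_ring integers k \<pi>
    unfolding k_def \<pi>_def by (rule P.rcos_ring_hom_ring)
  have carrier_k: "carrier k = \<pi> ` quadratic_order"
    by (auto simp: k_def \<pi>_def FactRing_def A_RCOSETS_def')
  have \<pi>_eq: "\<pi> x = \<pi> y \<longleftrightarrow> x - y \<in> P" if "x \<in> quadratic_order" "y \<in> quadratic_order" for x y
    unfolding \<pi>_def using P.is_ideal that by (rule coset_eq_iff)
  have Ints_subring: "subring \<int> integers"
  proof (rule integers.subringI)
    fix h :: complex assume h: "h \<in> \<int>"
    show "\<ominus>\<^bsub>integers\<^esub> h \<in> \<int>"
      unfolding integers_uminus[OF Ints_in_quadratic_order[OF h]] using h by (rule Ints_minus)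
  qed (auto intro: Ints_in_quadratic_order)
  define \<kappa> where "\<kappa> = \<pi> ` \<int>"
  have "subring \<kappa> k"
    unfolding \<kappa>_def using Ints_subring by (rule \<pi>.img_is_subring)
  then have cring_\<kappa>: "cring (k \<lparr>carrier := \<kappa>\<rparr>)"
    using k.subcringI' k.subcring_iff subringE(1) by blast
  have inv_\<kappa>: "\<exists>b\<in>\<kappa>. a \<otimes>\<^bsub>k\<^esub> b = \<one>\<^bsub>k\<^esub>" if a: "a \<in> \<kappa>" "a \<noteq> \<zero>\<^bsub>k\<^esub>" for a
  proof -
    obtain z :: int where z: "a = \<pi> (of_int z)"
      using a(1) unfolding \<kappa>_def by (auto elim: Ints_cases)
    have "\<pi> (of_int z) \<noteq> \<pi> 0"
      using a(2) \<pi>.hom_zero unfolding z by simp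
    then have "of_int z \<notin> P"
      using \<pi>_eq[of "of_int z" 0] Ints_in_quadratic_order[of 0] by simp
    then have "\<not> int p dvd z"
      using int_mem_prime_iff[OF P p] by simp
    then have "Rings.coprime (int p) z"
      using p(1) by (intro prime_imp_coprime) auto
    then obtain u v where uv: "u * int p + v * z = 1"
      using bezout_int[of "int p" z] by auto
    have "1 - of_int z * of_int v = of_nat p * complex_of_int u"
      using arg_cong[OF uv, of complex_of_int] by (simp add: algebra_simps)
    also have "\<dots> \<in> P"
      using P.I_r_closed[OF p(2), of "of_int u"] by auto
    finally have "\<pi> (of_int z * of_int v) = \<pi> 1"
      by (subst eq_commute, subst \<pi>_eq) (auto intro: Ints_in_quadratic_order)
    then have "a \<otimes>\<^bsub>k\<^esub> \<pi> (of_int v) = \<one>\<^bsub>k\<^esub>"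
      using \<pi>.hom_mult[of "of_int z" "of_int v"] \<pi>.hom_one by (simp add: z Ints_in_quadratic_order)
    moreover have "\<pi> (of_int v) \<in> \<kappa>"
      unfolding \<kappa>_def by (intro imageI Ints_of_int)
    ultimately show ?thesis
      by (rule bexI)
  qed
  have "Ring.field (k \<lparr>carrier := \<kappa>\<rparr>)"
    using inv_\<kappa> by (intro cring.cring_fieldI2[OF cring_\<kappa>]) simp_all
  then have \<kappa>: "subfield \<kappa> k"
    using \<open>subring \<kappa> k\<close> subringE(1) k.subfield_iff(1) by blast
  have gens: "set [\<pi> 1, \<pi> \<theta>] \<subseteq> carrier k"
    using \<pi>.hom_closed[of 1] \<pi>.hom_closed[of \<theta>] theta_in_quadratic_order
      Ints_in_quadratic_order[of 1] by simp
  have "carrier k \<subseteq> k.Span \<kappa> [\<pi> 1, \<pi> \<theta>]"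
  proof
    fix y assume "y \<in> carrier k"
    then obtain a b :: int where "y = \<pi> (of_int a + of_int b * \<theta>)"
      unfolding carrier_k by (auto elim: quadratic_orderE)
    then have "y = k.combine [\<pi> (of_int a), \<pi> (of_int b)] [\<pi> 1, \<pi> \<theta>]"
      using \<pi>.hom_add[of "of_int a" "of_int b * \<theta>"] \<pi>.hom_mult[of "of_int b" \<theta>]
        \<pi>.hom_mult[of "of_int a" 1] \<pi>.hom_closed[of "of_int b * \<theta>"]
      by (simp add: Ints_in_quadratic_order theta_in_quadratic_order quadratic_order_mult)
    moreover have "set [\<pi> (of_int a), \<pi> (of_int b)] \<subseteq> \<kappa>"
      unfolding \<kappa>_def by simp
    ultimately show "y \<in> k.Span \<kappa> [\<pi> 1, \<pi> \<theta>]"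
      unfolding k.Span_mem_iff_length_version[OF \<kappa> gens] by fastforce
  qed
  then have "k.Span \<kappa> [\<pi> 1, \<pi> \<theta>] = carrier k"
    using k.Span_subgroup_props(1)[OF \<kappa> gens] by blast
  then have fin: "k.finite_dimension \<kappa> (carrier k)"
    using k.Span_finite_dimension[OF \<kappa> gens] by simp
  have "range (\<lambda>z::int. P +>\<^bsub>integers\<^esub> of_int z) = \<kappa>"
    unfolding \<kappa>_def \<pi>_def Ints_def by auto
  then have "residue_degree quadratic_field P = k.dim \<kappa> (carrier k)"
    unfolding residue_degree_def Let_def k_def by simp
  then have "residue_degree quadratic_field P = 1 \<longleftrightarrow> carrier k = \<kappa>"
    using k.dim_eq_1_iff[OF \<kappa> fin] by simp
  also have "\<dots> \<longleftrightarrow> carrier k \<subseteq> \<kappa>"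
    using subringE(1)[OF \<open>subring \<kappa> k\<close>] by blast
  also have "\<dots> \<longleftrightarrow> (\<forall>x\<in>quadratic_order. \<exists>z :: int. \<pi> x = \<pi> (of_int z))"
    unfolding carrier_k \<kappa>_def Ints_def by blast
  also have "\<dots> \<longleftrightarrow> (\<forall>x\<in>quadratic_order. \<exists>z :: int. x - of_int z \<in> P)"
    by (auto simp: \<pi>_eq Ints_in_quadratic_order)
  finally show ?thesis .
qed

lemma genideal_integers:
  assumes "a \<in> quadratic_order"
  shows "genideal integers {a} = (\<lambda>y. y * a) ` quadratic_order"
  using integers.cgenideal_eq_genideal[of a] assms by (auto simp: cgenideal_def)

text \<open>
  With \<open>p\<O> = P\<^sup>e\<close>, an element \<open>x\<close> of \<open>P\<close> satisfies \<open>x\<^sup>e = p y\<close>; the conjugate equation puts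
  a power of the conjugate of \<open>x\<close> into \<open>P\<close>, which is prime.
\<close>

lemma cnj_mem_unique_prime_above:
  assumes p: "primes_above quadratic_field p = {P}" and x: "x \<in> P"
  shows "cnj x \<in> P"
proof -
  have P: "primeideal P integers" "of_nat p \<in> P"
    using primes_above_imp_prime[OF cring_integers, of p P] p by simp_all
  interpret P: primeideal P integers by fact
  obtain e :: nat where e: "e \<ge> 1" "genideal integers {of_nat p} = P [^]\<^bsub>ideals_set integers\<^esub> e"
    using primes_above_singleton[OF cring_integers p] by blast
  have x_order: "x \<in> quadratic_order"
    using P.Icarr[OF x] by simp
  have "x ^ e \<in> genideal integers {of_nat p}"
    using integers.pow_mem_ideal_pow[OF x, of e] e(2) by simp
  then obtain y where y: "y \<in> quadratic_order" "x ^ e = y * of_nat p"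
    using genideal_integers[of "of_nat p"] by auto
  have "cnj x ^ e = cnj y * of_nat p"
    using arg_cong[OF y(2), of cnj] by simp
  also have "\<dots> \<in> P"
    using P.I_l_closed[OF P(2), of "cnj y"] y(1) quadratic_order_cnj by simp
  finally have "cnj x ^ e \<in> P" .
  then show ?thesis
    using e(1)
  proof (induction e)
    case (Suc e)
    then have "cnj x \<in> P \<or> cnj x ^ e \<in> P"
      using P.I_prime[of "cnj x" "cnj x ^ e"] quadratic_order_cnj[OF x_order]
        quadratic_order_power by auto
    moreover have "cnj x ^ 0 \<notin> P"
      using P.one_imp_carrier P.I_notcarr by auto
    ultimately show ?case
      using Suc.IH by (cases e) auto
  qed simp
qed

text \<open>
  Here \<open>t\<^sup>2 - 4n\<close> is the discriminant of the field. The element \<open>\<theta>\<close> and its conjugate are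
  congruent to the same integer modulo \<open>P\<close>, so \<open>P\<close> contains the square of their difference, which
  is the discriminant.
\<close>

lemma splitting_type_ne_1_unramified:
  assumes p: "Factorial_Ring.prime p" and unram: "\<not> int p dvd t * t - 4 * n"
  shows "splitting_type quadratic_field p \<noteq> {#1#}"
proof
  assume "splitting_type quadratic_field p = {#1#}"
  then obtain P where P: "primes_above quadratic_field p = {P}" "residue_degree quadratic_field P = 1"
    by (rule splitting_type_singletonE)
  have prime: "primeideal P integers" "of_nat p \<in> P"
    using primes_above_imp_prime[OF cring_integers, of p P] P(1) by simp_all
  interpret P: primeideal P integers by fact
  obtain z :: int where z: "\<theta> - of_int z \<in> P"
    using residue_degree_eq_1_iff[OF prime(1) p prime(2)] P(2) theta_in_quadratic_order by blast
  have "cnj (\<theta> - of_int z) \<in> P"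
    using P(1) z by (rule cnj_mem_unique_prime_above)
  then have "(\<theta> - of_int z) \<ominus>\<^bsub>integers\<^esub> cnj (\<theta> - of_int z) \<in> P"
    unfolding a_minus_def using z by (intro P.a_closed P.a_inv_closed)
  then have "\<theta> - cnj \<theta> \<in> P"
    using quadratic_order_cnj[OF theta_in_quadratic_order] by (simp add: quadratic_order_diff)
  then have "(\<theta> - cnj \<theta>) * (\<theta> - cnj \<theta>) \<in> P"
    using P.I_l_closed[of "\<theta> - cnj \<theta>" "\<theta> - cnj \<theta>"] P.Icarr by simp
  also have "(\<theta> - cnj \<theta>) * (\<theta> - cnj \<theta>) = (\<theta> + cnj \<theta>) * (\<theta> + cnj \<theta>) - 4 * (\<theta> * cnj \<theta>)"
    by (simp add: algebra_simps)
  also have "\<dots> = of_int (t * t - 4 * n)"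
    unfolding trace norm by simp
  finally show False
    using unram int_mem_prime_iff[OF prime(1) p prime(2)] by blast
qed

end

section \<open>The prime 2 in the Gaussian integers\<close>

interpretation gaussian: norm_euclidean_quadratic \<i> 0 1
  by unfold_locales auto

abbreviation prime_over_2 :: "complex set" where
  "prime_over_2 \<equiv> genideal gaussian.integers {1 + \<i>}"

lemma one_plus_i_in_quadratic_order: "1 + \<i> \<in> gaussian.quadratic_order"
  using gaussian.quadratic_orderI[of 1 1] by simp

lemma one_plus_i_square: "(1 + \<i>) * (1 + \<i>) = 2 * \<i>"
  by (simp add: complex_eq_iff)

lemma prime_over_2_eq: "prime_over_2 = (\<lambda>y. y * (1 + \<i>)) ` gaussian.quadratic_order"
  using one_plus_i_in_quadratic_order by (rule gaussian.genideal_integers)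

lemma ideal_prime_over_2: "ideal prime_over_2 gaussian.integers"
  using one_plus_i_in_quadratic_order by (intro gaussian.integers.genideal_ideal) auto

text \<open>
  Otherwise \<open>1 + \<i>\<close> would have an inverse in \<open>\<int>[\<i>]\<close>, of absolute value \<open>1/\<surd>2 < 1\<close>.
\<close>

lemma one_notin_prime_over_2: "1 \<notin> prime_over_2"
proof
  assume "1 \<in> prime_over_2"
  then obtain y where y: "y \<in> gaussian.quadratic_order" "1 = y * (1 + \<i>)"
    unfolding prime_over_2_eq by blast
  have "cmod (1 + \<i>) = sqrt 2"
    by (simp add: cmod_def)
  then have "1 = cmod y * sqrt 2"
    using arg_cong[OF y(2), of cmod] by (simp add: norm_mult)
  moreover have "1 \<le> cmod y"
    using y by (intro gaussian.one_le_cmod_quadratic_order) auto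
  moreover have "sqrt 2 > 1"
    by simp
  ultimately show False
    using mult_mono[of 1 "cmod y" "sqrt 2" "sqrt 2"] by linarith
qed

text \<open>
  The residue field has two elements. This single fact gives primality, the residue degree, and the
  uniqueness of the prime above 2. The ideal consists of the \<open>a + b \<i>\<close> with \<open>a + b\<close> even.
\<close>

lemma prime_over_2_cases:
  assumes "x \<in> gaussian.quadratic_order"
  shows "x \<in> prime_over_2 \<or> x - 1 \<in> prime_over_2"
proof -
  have even: "of_int a + of_int b * \<i> \<in> prime_over_2" if even: "even (a + b)" for a b
  proof -
    obtain c where "a + b = 2 * c"
      using even by (rule evenE)
    then have a: "a = 2 * c - b"
      by simp
    have "of_int c + of_int (b - c) * \<i> \<in> gaussian.quadratic_order"
      by (intro gaussian.quadratic_orderI) auto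
    moreover have "of_int a + of_int b * \<i> = (of_int c + of_int (b - c) * \<i>) * (1 + \<i>)"
      by (simp add: a complex_eq_iff)
    ultimately show ?thesis
      unfolding prime_over_2_eq by blast
  qed
  obtain a b :: int where x: "x = of_int a + of_int b * \<i>"
    using assms by (rule gaussian.quadratic_orderE)
  show ?thesis
  proof (cases "even (a + b)")
    case True
    then show ?thesis
      using even x by blast
  next
    case False
    then have "of_int (a - 1) + of_int b * \<i> \<in> prime_over_2"
      by (intro even) auto
    then show ?thesis
      by (simp add: x algebra_simps)
  qed
qed

lemma primeideal_prime_over_2: "primeideal prime_over_2 gaussian.integers"
proof (rule primeidealI)
  interpret P: ideal prime_over_2 gaussian.integers
    by (rule ideal_prime_over_2)
  show "carrier gaussian.integers \<noteq> prime_over_2"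
    using one_notin_prime_over_2 gaussian.of_int_in_quadratic_order[of 1] by auto
  fix x y
  assume x: "x \<in> carrier gaussian.integers" and y: "y \<in> carrier gaussian.integers"
    and xy: "x \<otimes>\<^bsub>gaussian.integers\<^esub> y \<in> prime_over_2"
  show "x \<in> prime_over_2 \<or> y \<in> prime_over_2"
  proof (rule ccontr)
    assume "\<not> (x \<in> prime_over_2 \<or> y \<in> prime_over_2)"
    then have 1: "x - 1 \<in> prime_over_2" "y - 1 \<in> prime_over_2"
      using prime_over_2_cases x y by auto
    have "(x - 1) * y + (y - 1) \<in> prime_over_2"
      using P.a_closed[OF P.I_r_closed[OF 1(1) y] 1(2)] by simp
    then have "x * y \<ominus>\<^bsub>gaussian.integers\<^esub> ((x - 1) * y + (y - 1)) \<in> prime_over_2"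
      unfolding a_minus_def using xy by (intro P.a_closed P.a_inv_closed) auto
    then show False
      using one_notin_prime_over_2 P.Icarr[OF \<open>(x - 1) * y + (y - 1) \<in> prime_over_2\<close>]
      by (simp add: algebra_simps)
  qed
qed (use ideal_prime_over_2 gaussian.cring_integers in auto)

lemma prime_over_2_square: "prime_over_2 \<cdot>\<^bsub>gaussian.integers\<^esub> prime_over_2 = genideal gaussian.integers {2}"
proof (rule antisym)
  have two: "genideal gaussian.integers {2} = (\<lambda>y. y * 2) ` gaussian.quadratic_order"
    using gaussian.of_int_in_quadratic_order[of 2] by (intro gaussian.genideal_integers) simp
  interpret I: ideal "genideal gaussian.integers {2}" gaussian.integers
    using gaussian.of_int_in_quadratic_order[of 2] by (intro gaussian.integers.genideal_ideal) simp
  show "prime_over_2 \<cdot>\<^bsub>gaussian.integers\<^esub> prime_over_2 \<subseteq> genideal gaussian.integers {2}"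
  proof
    fix x assume "x \<in> prime_over_2 \<cdot>\<^bsub>gaussian.integers\<^esub> prime_over_2"
    then show "x \<in> genideal gaussian.integers {2}"
    proof induction
      case (prod i j)
      then obtain y z where yz: "y \<in> gaussian.quadratic_order" "z \<in> gaussian.quadratic_order"
        and ij: "i = y * (1 + \<i>)" "j = z * (1 + \<i>)"
        unfolding prime_over_2_eq by blast
      have "i * j = y * z * ((1 + \<i>) * (1 + \<i>))"
        unfolding ij by (simp only: mult_ac)
      then have "i * j = y * z * \<i> * 2"
        unfolding one_plus_i_square by (simp add: mult_ac)
      moreover have "y * z * \<i> \<in> gaussian.quadratic_order"
        using yz by (intro gaussian.quadratic_order_mult gaussian.theta_in_quadratic_order)
      ultimately show ?case
        unfolding two by auto
    next
      case (sum x y)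
      then show ?case
        by (intro I.a_closed)
    qed
  qed
  show "genideal gaussian.integers {2} \<subseteq> prime_over_2 \<cdot>\<^bsub>gaussian.integers\<^esub> prime_over_2"
  proof
    fix x assume "x \<in> genideal gaussian.integers {2}"
    then obtain y where y: "y \<in> gaussian.quadratic_order" "x = y * 2"
      unfolding two by blast
    \<comment> \<open>this is \<open>2 = - \<i> (1 + \<i>)\<^sup>2\<close>\<close>
    have "x = (y * (- \<i>) * (1 + \<i>)) * (1 * (1 + \<i>))"
      by (simp add: y complex_eq_iff algebra_simps)
    moreover have "y * (- \<i>) * (1 + \<i>) \<in> prime_over_2"
      unfolding prime_over_2_eq
      using y by (intro imageI gaussian.quadratic_order_mult gaussian.quadratic_order_uminus
          gaussian.theta_in_quadratic_order)
    moreover have "1 * (1 + \<i>) \<in> prime_over_2"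
      unfolding prime_over_2_eq using gaussian.of_int_in_quadratic_order[of 1] by (intro imageI) simp
    ultimately show "x \<in> prime_over_2 \<cdot>\<^bsub>gaussian.integers\<^esub> prime_over_2"
      using ideal_prod.prod[of _ prime_over_2 _ prime_over_2 gaussian.integers]
      by (metis gaussian.integers_simps(2))
  qed
qed

text \<open>
  Any prime \<open>Q\<close> above 2 contains \<open>(1 + \<i>)\<^sup>2 = 2 \<i>\<close>, hence \<open>1 + \<i>\<close>; the ideal generated by
  \<open>1 + \<i>\<close> is maximal, so it equals \<open>Q\<close>.
\<close>

lemma primes_above_2_gaussian: "primes_above gaussian.quadratic_field 2 = {prime_over_2}"
proof (intro antisym subsetI)
  interpret M: comm_monoid "ideals_set gaussian.integers"
    by (rule gaussian.integers.ideals_set_is_comm_monoid)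
  have prime_over_2: "prime_over_2 \<in> carrier (ideals_set gaussian.integers)"
    using ideal_prime_over_2 by (simp add: ideals_set_def)
  have "finprod (ideals_set gaussian.integers)
      (\<lambda>Q. Q [^]\<^bsub>ideals_set gaussian.integers\<^esub> (2 :: nat)) {prime_over_2} =
      prime_over_2 [^]\<^bsub>ideals_set gaussian.integers\<^esub> (2 :: nat)"
    using prime_over_2 M.nat_pow_closed[OF prime_over_2, of 2] by simp
  also have "\<dots> = prime_over_2 \<cdot>\<^bsub>gaussian.integers\<^esub> prime_over_2"
    using prime_over_2 by (simp add: numeral_2_eq_2) (simp add: ideals_set_def)
  finally have "prime_ideal_factorization gaussian.integers
      (genideal gaussian.integers {of_nat 2}) {prime_over_2} (\<lambda>_. 2)"
    unfolding prime_ideal_factorization_def using primeideal_prime_over_2 prime_over_2_square by simp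
  then have "prime_over_2 \<in> primes_above gaussian.quadratic_field 2"
    unfolding primes_above_def by blast
  then show "Q \<in> primes_above gaussian.quadratic_field 2" if "Q \<in> {prime_over_2}" for Q
    using that by simp
next
  fix Q assume "Q \<in> primes_above gaussian.quadratic_field 2"
  then have Q: "primeideal Q gaussian.integers" "2 \<in> Q"
    using primes_above_imp_prime[OF gaussian.cring_integers, of 2 Q]
      gaussian.of_nat_in_quadratic_order[of 2] by simp_all
  interpret Q: primeideal Q gaussian.integers by fact
  have "2 * \<i> \<in> Q"
    using Q.I_r_closed[OF Q(2), of \<i>] gaussian.theta_in_quadratic_order by simp
  then have "(1 + \<i>) * (1 + \<i>) \<in> Q"
    unfolding one_plus_i_square .
  then have "1 + \<i> \<in> Q"
    using Q.I_prime[of "1 + \<i>" "1 + \<i>"] one_plus_i_in_quadratic_order by simp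
  then have sub: "prime_over_2 \<subseteq> Q"
    using Q.is_ideal by (intro gaussian.integers.genideal_minimal) auto
  have "Q \<subseteq> prime_over_2"
  proof
    fix x assume x: "x \<in> Q"
    show "x \<in> prime_over_2"
    proof (rule ccontr)
      assume "x \<notin> prime_over_2"
      then have "x - 1 \<in> Q"
        using prime_over_2_cases Q.Icarr[OF x] sub by auto
      then have "x \<ominus>\<^bsub>gaussian.integers\<^esub> (x - 1) \<in> Q"
        unfolding a_minus_def using x by (intro Q.a_closed Q.a_inv_closed)
      then have "1 \<in> Q"
        using Q.Icarr[OF \<open>x - 1 \<in> Q\<close>] by simp
      then show False
        using Q.one_imp_carrier Q.I_notcarr by simp
    qed
  qed
  with sub show "Q \<in> {prime_over_2}"
    by blast
qed

lemma splitting_type_gaussian_2: "splitting_type gaussian.quadratic_field 2 = {#1#}"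
proof -
  have two: "of_nat 2 \<in> prime_over_2"
    using primes_above_imp_prime(2)[OF gaussian.cring_integers, of 2 prime_over_2]
      primes_above_2_gaussian gaussian.of_nat_in_quadratic_order[of 2] by simp
  have "\<exists>z :: int. x - of_int z \<in> prime_over_2" if "x \<in> gaussian.quadratic_order" for x
    using prime_over_2_cases[OF that]
  proof
    assume "x \<in> prime_over_2"
    then show ?thesis
      by (intro exI[of _ 0]) simp
  next
    assume "x - 1 \<in> prime_over_2"
    then show ?thesis
      by (intro exI[of _ 1]) simp
  qed
  then have "residue_degree gaussian.quadratic_field prime_over_2 = 1"
    using gaussian.residue_degree_eq_1_iff[OF primeideal_prime_over_2 _ two] two_is_prime_nat by blast
  then show ?thesis
    by (simp add: splitting_type_def primes_above_2_gaussian)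
qed

section \<open>A statistic that detects ramification in quadratic fields\<close>

definition \<omega> :: complex where
  "\<omega> = Complex (1 / 2) (sqrt 3 / 2)"

interpretation eisenstein: norm_euclidean_quadratic \<omega> 1 1
  by unfold_locales (auto simp: \<omega>_def complex_eq_iff power_divide)

definition degree_one_statistic :: "nat \<Rightarrow> complex set \<Rightarrow> nat multiset" where
  "degree_one_statistic p F = (if splitting_type F p = {#1#} then {#0#} else {#})"

lemma splitting_statistic_degree_one: "splitting_statistic degree_one_statistic"
proof -
  define f :: "nat \<Rightarrow> nat multiset \<Rightarrow> nat"
    where "f = (\<lambda>n M. if M = {#1#} \<and> n = 0 then 1 else 0)"
  have "count (degree_one_statistic p F) n = f n (splitting_type F p)" for p F n
    by (simp add: degree_one_statistic_def f_def)
  moreover have "set_mset (degree_one_statistic p F) \<subseteq> {..0}" for p F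
    by (simp add: degree_one_statistic_def)
  moreover have "size (degree_one_statistic p F) \<le> 1" for p F
    by (simp add: degree_one_statistic_def)
  ultimately show ?thesis
    unfolding splitting_statistic_def by blast
qed

text \<open>
  The discriminants of the two fields are \<open>-4\<close> and \<open>-3\<close>, so only 2 and 3 can be exceptional.
\<close>

theorem theorem1p5:
  shows "\<exists>S. admits_nonempty_exceptional_set S"
proof -
  let ?K = gaussian.quadratic_field and ?F = eisenstein.quadratic_field
  let ?E = "exceptional_set degree_one_statistic ?K ?F"
  have K: "splitting_type ?K p \<noteq> {#1#}" if "Factorial_Ring.prime p" "\<not> p dvd 4" for p
    using gaussian.splitting_type_ne_1_unramified[OF that(1)] that(2) int_dvd_int_iff[of p 4]
    by simp
  have F: "splitting_type ?F p \<noteq> {#1#}" if "Factorial_Ring.prime p" "\<not> p dvd 3" for p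
    using eisenstein.splitting_type_ne_1_unramified[OF that(1)] that(2) int_dvd_int_iff[of p 3]
    by simp
  have "?E \<subseteq> {p. p dvd 4} \<union> {p. p dvd 3}"
    using K F by (auto simp: exceptional_set_def degree_one_statistic_def)
  then have "finite ?E"
    by (rule finite_subset) simp
  then have "(?K, ?F) \<in> arithmetic_similarity degree_one_statistic"
    by (simp add: arithmetic_similarity_def gaussian.number_field_quadratic_field
        eisenstein.number_field_quadratic_field)
  moreover have "2 \<in> ?E"
    using F[of 2] splitting_type_gaussian_2
    by (simp add: exceptional_set_def degree_one_statistic_def)
  ultimately show ?thesis
    unfolding admits_nonempty_exceptional_set_def using splitting_statistic_degree_one by blast
qed

end
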